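(* For every integer $n\ge 1$ let $(G^3_n,\boldsymbol c^3_n)$ be the EWMCP instance and $\mathscr C^3_n$ the coloring of $G^3_n$, of cardinality $2$, defined in the context. Then $$\frac{\mathrm{UB}_1(G^3_n,\boldsymbol c^3_n,\mathscr C^3_n)}{\mathrm{UB}_3(G^3_n,\boldsymbol c^3_n,2)}\to+\infty\quad\text{as } n\to+\infty .$$
   Context: An instance of the Edge-Weighted Maximum Clique Problem (EWMCP) is a pair $(G,\boldsymbol c)$ where $G=(V,E)$ is a finite simple undirected graph and $\boldsymbol c=(c_e)_{e\in E}$ is a vector of nonnegative integer edge-weights. For $u\in V$, $\delta(u)\subseteq E$ is the set of edges incident to $u$. A coloring $\mathscr C$ of the vertices of $G$ is a partition of $V$ into disjoint non-empty independent sets (sets of pairwise non-adjacent vertices). First upper bound. $\mathrm{UB}_1(G,\boldsymbol c,\mathscr C)$ is the optimal value of the linear program, in real variables $\pi_I$ ($I\in\mathscr C$) and $\varrho_{eu},\varrho_{ev}$ (for each edge $e=\{u,v\}\in E$), $$\min \sum_{I\in\mathscr C}\pi_I$$ subject to $\varrho_{eu}+\varrho_{ev}=c_e$ for every $e=\{u,v\}\in E$; $\pi_I\ge\sum_{e\in\delta(u)}\varrho_{eu}$ for every $I\in\mathscr C$ and $u\in I$; and $\pi_I\ge0$, $\varrho_{eu}\ge0$, $\varrho_{ev}\ge0$ for all $I\in\mathscr C$ and all $e=\{u,v\}\in E$. Third upper bound. Let $k$ be an integer with $1\le k\le|V|$ that is an upper bound on the cardinality of every clique of $G$. For $u\in V$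 and an integer $t\ge0$, $\delta_t(u)\subseteq\delta(u)$ denotes any set of the $\min\{t,|\delta(u)|\}$ heaviest edges incident to $u$. Set $\eta_u:=\frac12\sum_{e\in\delta_{k-1}(u)}c_e$ for $u\in V$, and order the vertices as $\varphi(1),\dots,\varphi(|V|)$ with $\eta_{\varphi(1)}\ge\eta_{\varphi(2)}\ge\dots\ge\eta_{\varphi(|V|)}$ (ties broken arbitrarily). Then $$\mathrm{UB}_3(G,\boldsymbol c,k):=\sum_{j=1}^{k}\eta_{\varphi(j)}.$$ The instances. For every integer $n\ge1$, $G^3_n$ is the complete bipartite graph with vertex set $\{1,\dots,2n\}$ and parts $I=\{1,\dots,n\}$ and $J=\{n+1,\dots,2n\}$: there are no edges inside $I$ or inside $J$, and every vertex of $I$ is adjacent to every vertex of $J$. Every edge has weight $1$; these weights define $\boldsymbol c^3_n$. The coloring is $\mathscr C^3_n=\{I,J\}$. *)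

theory Defs
  imports Complex_Main "HOL-Library.Ramsey" "HOL-Library.Disjoint_Sets"
begin

text \<open>
  A graph is given by its vertex set \<open>V\<close> and its set \<open>E\<close> of edges, an edge being a
  two-element set of vertices. \<open>clique W E\<close> and \<open>indep W E\<close> from \<open>Ramsey\<close> say that the
  vertices in \<open>W\<close> are pairwise adjacent, respectively pairwise non-adjacent, for \<open>E\<close>.
  Weights are functions on all sets of vertices, of which only the values on \<open>E\<close> matter.
\<close>

definition finite_simple_graph :: "'a set \<Rightarrow> 'a set set \<Rightarrow> bool" where
  "finite_simple_graph V E \<longleftrightarrow>
     finite V \<and> (\<forall>e\<in>E. \<exists>u\<in>V. \<exists>v\<in>V. u \<noteq> v \<and> e = {u, v})"

definition coloring :: "'a set \<Rightarrow> 'a set set \<Rightarrow> 'a set set \<Rightarrow> bool" where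
  "coloring V E C \<longleftrightarrow> partition_on V C \<and> (\<forall>I\<in>C. indep I E)"

definition incident_edges :: "'a set set \<Rightarrow> 'a \<Rightarrow> 'a set set" where
  "incident_edges E u = {e \<in> E. u \<in> e}"


subsection \<open>The first upper bound\<close>

definition UB1_feasible ::
  "'a set set \<Rightarrow> ('a set \<Rightarrow> nat) \<Rightarrow> 'a set set \<Rightarrow> ('a set \<Rightarrow> real) \<Rightarrow> ('a set \<Rightarrow> 'a \<Rightarrow> real) \<Rightarrow> bool"
where
  "UB1_feasible E c C \<pi> \<rho> \<longleftrightarrow>
     (\<forall>u v. {u, v} \<in> E \<longrightarrow> \<rho> {u, v} u + \<rho> {u, v} v = real (c {u, v})) \<and>
     (\<forall>I\<in>C. \<forall>u\<in>I. \<pi> I \<ge> (\<Sum>e\<in>incident_edges E u. \<rho> e u)) \<and>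
     (\<forall>I\<in>C. \<pi> I \<ge> 0) \<and>
     (\<forall>e\<in>E. \<forall>u\<in>e. \<rho> e u \<ge> 0)"

definition UB1 :: "'a set set \<Rightarrow> ('a set \<Rightarrow> nat) \<Rightarrow> 'a set set \<Rightarrow> real" where
  "UB1 E c C = (LEAST z. \<exists>\<pi> \<rho>. UB1_feasible E c C \<pi> \<rho> \<and> z = (\<Sum>I\<in>C. \<pi> I))"


subsection \<open>The third upper bound\<close>

definition clique_bound :: "'a set \<Rightarrow> 'a set set \<Rightarrow> nat \<Rightarrow> bool" where
  "clique_bound V E k \<longleftrightarrow>
     1 \<le> k \<and> k \<le> card V \<and> (\<forall>W\<subseteq>V. clique W E \<longrightarrow> card W \<le> k)"

definition heaviest :: "('b \<Rightarrow> 'c::linorder) \<Rightarrow> nat \<Rightarrow> 'b set \<Rightarrow> 'b set \<Rightarrow> bool" where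
  "heaviest w t S D \<longleftrightarrow>
     D \<subseteq> S \<and> card D = min t (card S) \<and> (\<forall>e\<in>D. \<forall>f\<in>S - D. w f \<le> w e)"

definition nonincreasing_enum :: "'a set \<Rightarrow> ('a \<Rightarrow> real) \<Rightarrow> (nat \<Rightarrow> 'a) \<Rightarrow> bool" where
  "nonincreasing_enum V \<eta> \<phi> \<longleftrightarrow>
     bij_betw \<phi> {1..card V} V \<and> antimono_on {1..card V} (\<lambda>j. \<eta> (\<phi> j))"

definition eta :: "('a set \<Rightarrow> nat) \<Rightarrow> ('a \<Rightarrow> 'a set set) \<Rightarrow> 'a \<Rightarrow> real" where
  "eta c \<delta> u = (\<Sum>e\<in>\<delta> u. real (c e)) / 2"

text \<open>
  \<open>UB3_value V E c k b\<close>: some choice of the heaviest edges \<open>\<delta> u\<close> at every vertex \<open>u\<close> and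
  some ordering \<open>\<phi>\<close> of the vertices give the value \<open>b\<close>. Lemma \<open>UB3_value_ex1\<close> below shows
  that \<open>b\<close> exists and does not depend on the choices.
\<close>

definition UB3_value :: "'a set \<Rightarrow> 'a set set \<Rightarrow> ('a set \<Rightarrow> nat) \<Rightarrow> nat \<Rightarrow> real \<Rightarrow> bool" where
  "UB3_value V E c k b \<longleftrightarrow>
     (\<exists>\<delta> \<phi>. (\<forall>u\<in>V. heaviest c (k - 1) (incident_edges E u) (\<delta> u)) \<and>
            nonincreasing_enum V (eta c \<delta>) \<phi> \<and>
            b = (\<Sum>j=1..k. eta c \<delta> (\<phi> j)))"

definition UB3 :: "'a set \<Rightarrow> 'a set set \<Rightarrow> ('a set \<Rightarrow> nat) \<Rightarrow> nat \<Rightarrow> real" where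
  "UB3 V E c k = (THE b. UB3_value V E c k b)"

lemma finite_simple_graph_finite_edges:
  assumes "finite_simple_graph V E"
  shows "finite E"
proof (rule finite_subset)
  show "E \<subseteq> Pow V" using assms by (force simp: finite_simple_graph_def)
  show "finite (Pow V)" using assms by (simp add: finite_simple_graph_def)
qed

lemma nonincreasing_enum_ex:
  assumes "finite V"
  shows "\<exists>\<phi>. nonincreasing_enum V \<eta> \<phi>"
proof -
  obtain xs where xs: "set xs = V" "distinct xs"
    using assms finite_distinct_list by blast
  define ys where "ys = sort_key (\<lambda>x. - \<eta> x) xs"
  have ys: "set ys = V" "distinct ys" "length ys = card V" "sorted (map (\<lambda>x. - \<eta> x) ys)"
    using xs distinct_card[of xs] by (simp_all add: ys_def)
  have b1: "bij_betw (\<lambda>j. j - 1) {1..card V} {..<card V}"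
    by (rule bij_betw_byWitness[where f' = Suc]) auto
  have b2: "bij_betw (\<lambda>i. ys ! i) {..<card V} V"
    by (rule bij_betw_nth) (simp_all add: ys)
  have b3: "bij_betw (\<lambda>j. ys ! (j - 1)) {1..card V} V"
    using bij_betw_trans[OF b1 b2] by (simp only: comp_def)
  have m: "antimono_on {1..card V} (\<lambda>j. \<eta> (ys ! (j - 1)))"
  proof (rule monotone_onI)
    fix i j assume ij: "i \<in> {1..card V}" "j \<in> {1..card V}" "i \<le> j"
    then have "i - 1 \<le> j - 1" "j - 1 < length ys" using ys(3) by auto
    then have "map (\<lambda>x. - \<eta> x) ys ! (i - 1) \<le> map (\<lambda>x. - \<eta> x) ys ! (j - 1)"
      using ys(4) by (intro sorted_nth_mono) auto
    then show "\<eta> (ys ! (j - 1)) \<le> \<eta> (ys ! (i - 1))"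
      using \<open>i - 1 \<le> j - 1\<close> \<open>j - 1 < length ys\<close> by simp
  qed
  show ?thesis
    unfolding nonincreasing_enum_def using b3 m by blast
qed

lemma nonincreasing_enum_heaviest:
  assumes "nonincreasing_enum V \<eta> \<phi>" "k \<le> card V"
  shows "heaviest \<eta> k V (\<phi> ` {1..k})" "inj_on \<phi> {1..k}"
proof -
  have b: "bij_betw \<phi> {1..card V} V" and m: "antimono_on {1..card V} (\<lambda>j. \<eta> (\<phi> j))"
    using assms(1) by (auto simp: nonincreasing_enum_def)
  have sub: "{1..k} \<subseteq> {1..card V}" using assms(2) by auto
  show inj: "inj_on \<phi> {1..k}"
    using b sub unfolding bij_betw_def by (blast intro: inj_on_subset)
  have im: "\<phi> ` {1..card V} = V" using b by (simp add: bij_betw_def)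
  have "\<eta> f \<le> \<eta> e" if ef: "e \<in> \<phi> ` {1..k}" "f \<in> V - \<phi> ` {1..k}" for e f
  proof -
    obtain i where i: "i \<in> {1..k}" "e = \<phi> i" using ef(1) by (metis imageE)
    obtain j where j: "j \<in> {1..card V}" "f = \<phi> j" using ef(2) im by (metis DiffD1 imageE)
    have "j \<notin> {1..k}" using ef j by auto
    then have "i \<le> j" using i j by auto
    then show ?thesis using monotone_onD[OF m, of i j] i j sub by auto
  qed
  then show "heaviest \<eta> k V (\<phi> ` {1..k})"
    using im sub inj assms(2) by (auto simp: heaviest_def card_image)
qed

lemma heaviest_ex:
  fixes w :: "'b \<Rightarrow> nat"
  assumes "finite S"
  shows "\<exists>D. heaviest w t S D"
proof -
  obtain \<phi> where \<phi>: "nonincreasing_enum S (\<lambda>x. real (w x)) \<phi>"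
    using nonincreasing_enum_ex[OF assms] by blast
  define D where "D = \<phi> ` {1..min t (card S)}"
  have "heaviest (\<lambda>x. real (w x)) (min t (card S)) S D"
    using nonincreasing_enum_heaviest(1)[OF \<phi>] by (simp add: D_def)
  then have "heaviest w t S D" by (simp add: heaviest_def)
  then show ?thesis by blast
qed

lemma heaviest_sum_eq:
  fixes w :: "'b \<Rightarrow> 'c::linorder" and r :: "'c \<Rightarrow> real"
  assumes S: "finite S" and A: "heaviest w t S A" and B: "heaviest w t S B"
  shows "(\<Sum>x\<in>A. r (w x)) = (\<Sum>x\<in>B. r (w x))"
proof -
  have fin: "finite A" "finite B" and cd: "card A = card B"
    using A B S by (auto simp: heaviest_def intro: finite_subset)
  have cd': "card (A - B) = card (B - A)"
    using cd fin by (simp add: card_Diff_subset_Int Int_commute)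
  have eq: "w a = w b" if "a \<in> A - B" "b \<in> B - A" for a b
  proof (rule antisym)
    show "w a \<le> w b" "w b \<le> w a"
      using that A B by (auto simp: heaviest_def subset_iff)
  qed
  have "(\<Sum>x\<in>A - B. r (w x)) = (\<Sum>x\<in>B - A. r (w x))"
  proof (cases "A - B = {}")
    case True
    then have "card (B - A) = 0" using cd' by (metis card.empty)
    then have "B - A = {}" using fin by simp
    with True show ?thesis by simp
  next
    case False
    then obtain a where a: "a \<in> A - B" by blast
    have "card (B - A) \<noteq> 0" using False cd' fin by (metis card_0_eq finite_Diff)
    then have "B - A \<noteq> {}" by force
    then obtain b where b: "b \<in> B - A" by blast
    have "(\<Sum>x\<in>A - B. r (w x)) = (\<Sum>x\<in>A - B. r (w b))"
      by (rule sum.cong[OF refl]) (simp only: eq[OF _ b])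
    moreover have "(\<Sum>x\<in>B - A. r (w x)) = (\<Sum>x\<in>B - A. r (w a))"
      by (rule sum.cong[OF refl]) (simp only: eq[OF a])
    ultimately show ?thesis by (simp only: sum_constant cd' eq[OF a b])
  qed
  then show ?thesis
    using sum.Int_Diff[OF fin(1), of "\<lambda>x. r (w x)" B]
      sum.Int_Diff[OF fin(2), of "\<lambda>x. r (w x)" A] by (simp add: Int_commute)
qed

lemma UB3_value_ex1:
  assumes G: "finite_simple_graph V E" and k: "k \<le> card V"
  shows "\<exists>!b. UB3_value V E c k b"
proof -
  have fV: "finite V" using G by (simp add: finite_simple_graph_def)
  have fI: "finite (incident_edges E u)" for u
    using finite_simple_graph_finite_edges[OF G] by (simp add: incident_edges_def)
  obtain \<delta> where \<delta>: "\<And>u. heaviest c (k - 1) (incident_edges E u) (\<delta> u)"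
    using heaviest_ex[OF fI] by metis
  obtain \<phi> where "nonincreasing_enum V (eta c \<delta>) \<phi>"
    using nonincreasing_enum_ex[OF fV] by blast
  then have "UB3_value V E c k (\<Sum>j=1..k. eta c \<delta> (\<phi> j))"
    using \<delta> unfolding UB3_value_def by blast
  moreover have "b = b'" if vals: "UB3_value V E c k b" "UB3_value V E c k b'" for b b'
  proof -
    obtain \<delta> \<phi> where 1: "\<forall>u\<in>V. heaviest c (k - 1) (incident_edges E u) (\<delta> u)"
      "nonincreasing_enum V (eta c \<delta>) \<phi>" "b = (\<Sum>j=1..k. eta c \<delta> (\<phi> j))"
      using vals(1) unfolding UB3_value_def by blast
    obtain \<delta>' \<phi>' where 2: "\<forall>u\<in>V. heaviest c (k - 1) (incident_edges E u) (\<delta>' u)"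
      "nonincreasing_enum V (eta c \<delta>') \<phi>'" "b' = (\<Sum>j=1..k. eta c \<delta>' (\<phi>' j))"
      using vals(2) unfolding UB3_value_def by blast
    have eq: "eta c \<delta> u = eta c \<delta>' u" if "u \<in> V" for u
      using heaviest_sum_eq[OF fI, of c "k - 1" u "\<delta> u" "\<delta>' u" real] 1(1) 2(1) that
      by (simp add: eta_def)
    have h: "heaviest (eta c \<delta>) k V (\<phi> ` {1..k})" and i: "inj_on \<phi> {1..k}"
      using nonincreasing_enum_heaviest[OF 1(2) k] by auto
    have h': "heaviest (eta c \<delta>') k V (\<phi>' ` {1..k})" and i': "inj_on \<phi>' {1..k}"
      using nonincreasing_enum_heaviest[OF 2(2) k] by auto
    have sub: "\<phi>' ` {1..k} \<subseteq> V" using h' by (simp add: heaviest_def)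
    have h'': "heaviest (eta c \<delta>) k V (\<phi>' ` {1..k})"
      using h' sub unfolding heaviest_def by (auto simp: eq subset_iff)
    have "b = (\<Sum>x\<in>\<phi> ` {1..k}. eta c \<delta> x)" using 1(3) i by (simp add: sum.reindex)
    also have "\<dots> = (\<Sum>x\<in>\<phi>' ` {1..k}. eta c \<delta> x)"
      using heaviest_sum_eq[OF fV h h'', of "\<lambda>x. x"] .
    also have "\<dots> = (\<Sum>x\<in>\<phi>' ` {1..k}. eta c \<delta>' x)"
      using eq sub by (intro sum.cong) auto
    also have "\<dots> = b'" using 2(3) i' by (simp add: sum.reindex)
    finally show ?thesis .
  qed
  ultimately show ?thesis by blast
qed


subsection \<open>The complete bipartite instances\<close>

definition I3 :: "nat \<Rightarrow> nat set" where
  "I3 n = {1..n}"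

definition J3 :: "nat \<Rightarrow> nat set" where
  "J3 n = {n + 1..2 * n}"

definition V3 :: "nat \<Rightarrow> nat set" where
  "V3 n = {1..2 * n}"

definition E3 :: "nat \<Rightarrow> nat set set" where
  "E3 n = {{u, v} | u v. u \<in> I3 n \<and> v \<in> J3 n}"

definition c3 :: "nat \<Rightarrow> nat set \<Rightarrow> nat" where
  "c3 n = (\<lambda>e. 1)"

definition C3 :: "nat \<Rightarrow> nat set set" where
  "C3 n = {I3 n, J3 n}"

end

theory Submission
  imports Defs
begin

text \<open>
  The two bounds can be computed exactly: the first one is \<open>n\<close> and the third one is \<open>1\<close>,
  so their ratio is \<open>n\<close> whenever \<open>n \<ge> 1\<close>.

  For the first bound, weigh the constraint of each vertex equally. Every edge splits its
  weight between its two endpoints, so the constraints of all vertices together say that the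
  total edge weight is at most \<open>\<Sum>I\<in>C. card I * \<pi> I\<close> (\<open>UB1_feasible_total_weight\<close>). Here there
  are \<open>n\<^sup>2\<close> edges of weight one and both colors contain \<open>n\<close> vertices, which forces
  \<open>\<Sum>I\<in>C. \<pi> I \<ge> n\<close>. Splitting every edge evenly gives each vertex the load \<open>n / 2\<close>, hence
  \<open>\<pi> I = n / 2\<close> for both colors, and attains this value (\<open>UB1_bipartite\<close>).

  The third bound looks only at one incident edge per vertex, because no clique of a bipartite
  graph has more than two vertices. So \<open>\<eta>\<close> is \<open>1 / 2\<close> at every vertex however large the
  degrees are, and adding two of these numbers gives \<open>1\<close> (\<open>UB3_bipartite\<close>).
\<close>

text \<open>
  Double counting of the pairs of an edge and an endpoint: the loads \<open>\<rho> e u\<close> sum up to the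
  total weight when they are grouped by edges, and each vertex of a color \<open>I\<close> carries at most
  \<open>\<pi> I\<close> when they are grouped by vertices.
\<close>

lemma UB1_feasible_total_weight:
  assumes G: "finite_simple_graph V E" and C: "coloring V E C"
    and feas: "UB1_feasible E c C \<pi> \<rho>"
  shows "(\<Sum>e\<in>E. real (c e)) \<le> (\<Sum>I\<in>C. real (card I) * \<pi> I)"
proof -
  have fV: "finite V" and fE: "finite E"
    using G finite_simple_graph_finite_edges by (auto simp: finite_simple_graph_def)
  have part: "partition_on V C" using C by (simp add: coloring_def)
  have V: "V = \<Union>C" using part by (simp add: partition_on_def)
  have fI: "\<forall>I\<in>C. finite I" using fV V by (auto intro: finite_subset)
  have disj: "\<forall>A\<in>C. \<forall>B\<in>C. A \<noteq> B \<longrightarrow> A \<inter> B = {}"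
    using part by (auto simp: partition_on_def disjoint_def)
  have edge: "real (c e) = (\<Sum>u\<in>{u \<in> V. u \<in> e}. \<rho> e u)" if e: "e \<in> E" for e
  proof -
    obtain u v where uv: "u \<in> V" "v \<in> V" "u \<noteq> v" "e = {u, v}"
      using G e unfolding finite_simple_graph_def by blast
    have "{w \<in> V. w \<in> e} = {u, v}" using uv by auto
    moreover have "\<rho> e u + \<rho> e v = real (c e)"
      using feas e uv by (auto simp: UB1_feasible_def)
    ultimately show ?thesis using uv(3) by simp
  qed
  have "(\<Sum>e\<in>E. real (c e)) = (\<Sum>e\<in>E. \<Sum>u\<in>{u \<in> V. u \<in> e}. \<rho> e u)"
    by (intro sum.cong refl edge)
  also have "\<dots> = (\<Sum>u\<in>V. \<Sum>e\<in>incident_edges E u. \<rho> e u)"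
    unfolding incident_edges_def by (rule sum.swap_restrict[OF fE fV])
  also have "\<dots> = (\<Sum>I\<in>C. \<Sum>u\<in>I. \<Sum>e\<in>incident_edges E u. \<rho> e u)"
    using sum.Union_disjoint[OF fI disj] by (simp add: V)
  also have "\<dots> \<le> (\<Sum>I\<in>C. \<Sum>u\<in>I. \<pi> I)"
    using feas by (intro sum_mono) (auto simp: UB1_feasible_def)
  finally show ?thesis by simp
qed

lemma finite_simple_graph_bipartite: "finite_simple_graph (V3 n) (E3 n)"
proof -
  have "u \<in> V3 n \<and> v \<in> V3 n \<and> u \<noteq> v" if "u \<in> I3 n" "v \<in> J3 n" for u v
    using that by (auto simp: V3_def I3_def J3_def)
  moreover have "finite (V3 n)" by (simp add: V3_def)
  ultimately show ?thesis unfolding finite_simple_graph_def E3_def by blast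
qed

lemma E3_iff:
  "{u, v} \<in> E3 n \<longleftrightarrow> u \<in> I3 n \<and> v \<in> J3 n \<or> v \<in> I3 n \<and> u \<in> J3 n"
  by (auto simp: E3_def doubleton_eq_iff)

lemma I3_neq_J3: "n \<ge> 1 \<Longrightarrow> I3 n \<noteq> J3 n"
  by (simp add: I3_def J3_def)

lemma coloring_bipartite:
  assumes "n \<ge> 1"
  shows "coloring (V3 n) (E3 n) (C3 n)"
proof -
  have "partition_on (V3 n) (C3 n)"
    using assms by (auto simp: partition_on_def disjoint_def V3_def C3_def I3_def J3_def)
  moreover have "indep (I3 n) (E3 n)" "indep (J3 n) (E3 n)"
    by (auto simp: indep_def E3_iff I3_def J3_def)
  ultimately show ?thesis by (simp add: coloring_def C3_def)
qed

text \<open>A clique contains at most one vertex of each part.\<close>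

lemma clique_bound_bipartite:
  assumes "n \<ge> 1"
  shows "clique_bound (V3 n) (E3 n) 2"
proof -
  have "card W \<le> 2" if W: "W \<subseteq> V3 n" "clique W (E3 n)" for W
  proof -
    have "card (W \<inter> I3 n) \<le> 1" "card (W \<inter> J3 n) \<le> 1"
      using W(2) by (intro card_le_Suc0_iff_eq[THEN iffD2, folded One_nat_def];
          force simp: clique_def E3_iff I3_def J3_def)+
    moreover have "W = (W \<inter> I3 n) \<union> (W \<inter> J3 n)"
      using W(1) by (auto simp: V3_def I3_def J3_def)
    then have "card W \<le> card (W \<inter> I3 n) + card (W \<inter> J3 n)"
      by (metis card_Un_le)
    ultimately show ?thesis by simp
  qed
  then show ?thesis using assms by (simp add: clique_bound_def V3_def)
qed

lemma card_E3: "card (E3 n) = n * n"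
proof -
  have "E3 n = (\<lambda>(u, v). {u, v}) ` (I3 n \<times> J3 n)"
    by (auto simp: E3_def)
  moreover have "inj_on (\<lambda>(u, v). {u, v}) (I3 n \<times> J3 n)"
    by (auto simp: inj_on_def doubleton_eq_iff I3_def J3_def)
  ultimately show ?thesis
    by (simp add: card_image card_cartesian_product I3_def J3_def)
qed

lemma card_incident_edges_bipartite:
  assumes "u \<in> V3 n"
  shows "card (incident_edges (E3 n) u) = n"
proof -
  define N where "N = (if u \<in> I3 n then J3 n else I3 n)"
  have "incident_edges (E3 n) u = (\<lambda>v. {u, v}) ` N"
  proof
    show "incident_edges (E3 n) u \<subseteq> (\<lambda>v. {u, v}) ` N"
      by (auto simp: incident_edges_def E3_def N_def I3_def J3_def)
    show "(\<lambda>v. {u, v}) ` N \<subseteq> incident_edges (E3 n) u"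
      using assms by (auto simp: incident_edges_def E3_iff N_def V3_def I3_def J3_def)
  qed
  moreover have "inj_on (\<lambda>v. {u, v}) N"
    by (auto simp: inj_on_def doubleton_eq_iff)
  moreover have "card N = n" by (simp add: N_def I3_def J3_def)
  ultimately show ?thesis by (simp add: card_image)
qed

lemma UB1_bipartite:
  assumes n: "n \<ge> 1"
  shows "UB1 (E3 n) (c3 n) (C3 n) = real n"
  unfolding UB1_def
proof (rule Least_equality)
  have "UB1_feasible (E3 n) (c3 n) (C3 n) (\<lambda>_. real n / 2) (\<lambda>_ _. 1 / 2)"
    using card_incident_edges_bipartite[of _ n]
    by (auto simp: UB1_feasible_def c3_def C3_def V3_def I3_def J3_def)
  moreover have "real n = (\<Sum>I\<in>C3 n. real n / 2)"
    using I3_neq_J3[OF n] by (simp add: C3_def)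
  ultimately show "\<exists>\<pi> \<rho>. UB1_feasible (E3 n) (c3 n) (C3 n) \<pi> \<rho> \<and> real n = (\<Sum>I\<in>C3 n. \<pi> I)"
    by (intro exI[of _ "\<lambda>_. real n / 2"] exI[of _ "\<lambda>_ _. 1 / 2"]) simp
next
  fix z assume "\<exists>\<pi> \<rho>. UB1_feasible (E3 n) (c3 n) (C3 n) \<pi> \<rho> \<and> z = (\<Sum>I\<in>C3 n. \<pi> I)"
  then obtain \<pi> \<rho> where
    feas: "UB1_feasible (E3 n) (c3 n) (C3 n) \<pi> \<rho>" and z: "z = (\<Sum>I\<in>C3 n. \<pi> I)"
    by blast
  have "real n * real n = (\<Sum>e\<in>E3 n. real (c3 n e))"
    by (simp add: c3_def card_E3)
  also have "\<dots> \<le> (\<Sum>I\<in>C3 n. real (card I) * \<pi> I)"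
    using finite_simple_graph_bipartite coloring_bipartite[OF n] feas
    by (rule UB1_feasible_total_weight)
  also have "\<dots> = (\<Sum>I\<in>C3 n. real n * \<pi> I)"
    by (rule sum.cong) (auto simp: C3_def I3_def J3_def)
  also have "\<dots> = real n * z"
    by (simp add: z sum_distrib_left)
  finally show "real n \<le> z" using n by simp
qed

lemma UB3_bipartite:
  assumes n: "n \<ge> 1"
  shows "UB3 (V3 n) (E3 n) (c3 n) 2 = 1"
proof -
  have k: "2 \<le> card (V3 n)" using n by (simp add: V3_def)
  have one: "b = 1" if val: "UB3_value (V3 n) (E3 n) (c3 n) 2 b" for b
  proof -
    obtain \<delta> \<phi> where
      \<delta>: "\<forall>u\<in>V3 n. heaviest (c3 n) (2 - 1) (incident_edges (E3 n) u) (\<delta> u)" and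
      \<phi>: "nonincreasing_enum (V3 n) (eta (c3 n) \<delta>) \<phi>" and
      b: "b = (\<Sum>j=1..2. eta (c3 n) \<delta> (\<phi> j))"
      using val unfolding UB3_value_def by blast
    have half: "eta (c3 n) \<delta> u = 1 / 2" if "u \<in> V3 n" for u
    proof -
      have "card (\<delta> u) = 1"
        using \<delta> that n card_incident_edges_bipartite[OF that] by (auto simp: heaviest_def)
      then show ?thesis by (simp add: eta_def c3_def)
    qed
    have "\<phi> j \<in> V3 n" if "j \<in> {1..2}" for j
    proof -
      have "j \<in> {1..card (V3 n)}" using that k by simp
      then show ?thesis
        using \<phi> bij_betw_apply unfolding nonincreasing_enum_def by metis
    qed
    then have "b = (\<Sum>j=1..2::nat. 1 / 2)"
      unfolding b by (intro sum.cong refl half)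
    then show ?thesis by simp
  qed
  have "UB3_value (V3 n) (E3 n) (c3 n) 2 (UB3 (V3 n) (E3 n) (c3 n) 2)"
    unfolding UB3_def by (rule theI'[OF UB3_value_ex1[OF finite_simple_graph_bipartite k]])
  then show ?thesis by (rule one)
qed

theorem proposition9:
  shows "(\<forall>n\<ge>1. finite_simple_graph (V3 n) (E3 n) \<and>
                 coloring (V3 n) (E3 n) (C3 n) \<and> card (C3 n) = 2 \<and>
                 clique_bound (V3 n) (E3 n) 2) \<and>
         filterlim (\<lambda>n. UB1 (E3 n) (c3 n) (C3 n) / UB3 (V3 n) (E3 n) (c3 n) 2)
           at_top sequentially"
proof (intro conjI allI impI)
  fix n :: nat assume n: "1 \<le> n"
  show "finite_simple_graph (V3 n) (E3 n)" by (rule finite_simple_graph_bipartite)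
  show "coloring (V3 n) (E3 n) (C3 n)" by (rule coloring_bipartite[OF n])
  show "card (C3 n) = 2" using I3_neq_J3[OF n] by (simp add: C3_def)
  show "clique_bound (V3 n) (E3 n) 2" by (rule clique_bound_bipartite[OF n])
next
  have "\<forall>\<^sub>F n in sequentially.
      real n = UB1 (E3 n) (c3 n) (C3 n) / UB3 (V3 n) (E3 n) (c3 n) 2"
    using eventually_ge_at_top[of 1]
    by eventually_elim (simp add: UB1_bipartite UB3_bipartite)
  then show "filterlim (\<lambda>n. UB1 (E3 n) (c3 n) (C3 n) / UB3 (V3 n) (E3 n) (c3 n) 2)
      at_top sequentially"
    by (rule filterlim_mono_eventually[OF filterlim_real_sequentially order_refl order_refl])
qed

end
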